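(* Let $p$ be a prime. For each integer $a \geq 1$, the sequence of simplicial complexes $\{\mathbf{K}_p(\mathfrak{S}_n,a)\}_{n}$ is highly acyclic. More precisely, for every integer $k \geq 0$, the complex $\mathbf{K}_p(\mathfrak{S}_n,a)$ is $k$-acyclic for all $n \geq 2(k+2)ap-1$.
   Context: $\mathfrak{S}_n$ is the symmetric group on $n$ letters. For a prime $p$ and an integer $a\ge 0$, $\Lambda_p(\mathfrak{S}_n,a)$ is the graph whose vertices are the elements of order $p$ in $\mathfrak{S}_n$ that can be written as a product of at most $a$ disjoint $p$-cycles, with an edge between two distinct vertices exactly when they commute. $\mathbf{K}_p(\mathfrak{S}_n,a)$ is the clique complex of this graph: its $k$-simplices are the sets of $k+1$ pairwise commuting vertices. All homology is with $\mathbb{Z}$ coefficients. A simplicial complex $X$ is $k$-acyclic if the reduced homology $\widetilde{H}_t(X)$ vanishes for all $t\le k$. A sequence $\{X_n\}$ of simplicial complexes is highly acyclic if for each $k\ge 0$, the complex $X_n$ is $k$-acyclic for all sufficiently large $n$. *)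

theory Defs
  imports
    "HOL-Computational_Algebra.Primes"
    "HOL-Algebra.Free_Abelian_Groups"
    "HOL-Algebra.Multiplicative_Group"
    "HOL-Algebra.Sym_Groups"
    "Graph_Theory.Pair_Digraph"
begin

section \<open>Simplicial complexes and their reduced homology\<close>

text \<open>
  Complexes contain the empty simplex, placed in degree \<open>-1\<close>. The chain complex below is thus the
  augmented one: its boundary map in degree \<open>0\<close> sends every vertex to the empty simplex, i.e. it is
  the augmentation, and its homology is the reduced homology. In degree \<open>-1\<close> that homology is zero
  exactly when there is a vertex, and below degree \<open>-1\<close> it is always zero.
\<close>

definition abstract_simplicial_complex :: "'a set set \<Rightarrow> bool" where
  "abstract_simplicial_complex K \<longleftrightarrow>
     {} \<in> K \<and> (\<forall>S\<in>K. finite S \<and> (\<forall>T. T \<subseteq> S \<longrightarrow> T \<in> K))"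

definition simplices :: "'a set set \<Rightarrow> int \<Rightarrow> 'a set set" where
  "simplices K t = {S \<in> K. finite S \<and> int (card S) = t + 1}"

definition simplicial_chain_group :: "'a set set \<Rightarrow> int \<Rightarrow> ('a set \<Rightarrow>\<^sub>0 int) monoid" where
  "simplicial_chain_group K t = free_Abelian_group (simplices K t)"

text \<open>
  Simplices are oriented by a linear order \<open>r\<close> of the vertices: the \<open>i\<close>-th vertex of \<open>S\<close>
  (counting from \<open>0\<close>) is the one with exactly \<open>i\<close> predecessors in \<open>S\<close>.
\<close>

definition vertex_position :: "'a rel \<Rightarrow> 'a set \<Rightarrow> 'a \<Rightarrow> nat" where
  "vertex_position r S v = card {u \<in> S. u \<noteq> v \<and> (u, v) \<in> r}"

definition simplex_boundary :: "'a rel \<Rightarrow> 'a set \<Rightarrow> ('a set \<Rightarrow>\<^sub>0 int)" where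
  "simplex_boundary r S =
     (\<Sum>v\<in>S. frag_cmul ((-1) ^ vertex_position r S v) (frag_of (S - {v})))"

definition simplicial_boundary :: "'a rel \<Rightarrow> ('a set \<Rightarrow>\<^sub>0 int) \<Rightarrow> ('a set \<Rightarrow>\<^sub>0 int)" where
  "simplicial_boundary r = frag_extend (simplex_boundary r)"

definition simplicial_cycles :: "'a rel \<Rightarrow> 'a set set \<Rightarrow> int \<Rightarrow> ('a set \<Rightarrow>\<^sub>0 int) set" where
  "simplicial_cycles r K t =
     kernel (simplicial_chain_group K t) (simplicial_chain_group K (t - 1)) (simplicial_boundary r)"

definition simplicial_boundaries :: "'a rel \<Rightarrow> 'a set set \<Rightarrow> int \<Rightarrow> ('a set \<Rightarrow>\<^sub>0 int) set" where
  "simplicial_boundaries r K t =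
     simplicial_boundary r ` carrier (simplicial_chain_group K (t + 1))"

definition reduced_simplicial_homology ::
    "'a rel \<Rightarrow> 'a set set \<Rightarrow> int \<Rightarrow> ('a set \<Rightarrow>\<^sub>0 int) set monoid" where
  "reduced_simplicial_homology r K t =
     subgroup_generated (simplicial_chain_group K t) (simplicial_cycles r K t)
       Mod simplicial_boundaries r K t"

text \<open>
  Up to isomorphism the homology groups do not depend on the vertex order, so acyclicity is
  required for every choice of it; a vertex order always exists (\<open>ex_vertex_order\<close>).
\<close>

definition k_acyclic :: "int \<Rightarrow> 'a set set \<Rightarrow> bool" where
  "k_acyclic k K \<longleftrightarrow>
     (\<forall>r. linear_order_on (\<Union>K) r \<longrightarrow>
       (\<forall>t\<le>k. trivial_group (reduced_simplicial_homology r K t)))"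

definition highly_acyclic :: "(nat \<Rightarrow> 'a set set) \<Rightarrow> bool" where
  "highly_acyclic Y \<longleftrightarrow> (\<forall>k\<ge>0. \<forall>\<^sub>F n in sequentially. k_acyclic k (Y n))"

lemma ex_vertex_order: "\<exists>r. linear_order_on (\<Union>K) r"
  using well_order_on[of "\<Union>K"] by (auto simp: well_order_on_def)

lemma vertex_position_swap:
  assumes r: "linear_order_on A r" and S: "finite S" "S \<subseteq> A" and vw: "v \<in> S" "w \<in> S" "v \<noteq> w"
    and le: "(v, w) \<in> r"
  shows "vertex_position r (S - {w}) v = vertex_position r S v"
    and "vertex_position r S w = Suc (vertex_position r (S - {v}) w)"
proof -
  have "(w, v) \<notin> r"
    using r le vw by (auto simp: linear_order_on_def partial_order_on_def antisym_def)
  then have "{u \<in> S - {w}. u \<noteq> v \<and> (u, v) \<in> r} = {u \<in> S. u \<noteq> v \<and> (u, v) \<in> r}"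
    by auto
  then show "vertex_position r (S - {w}) v = vertex_position r S v"
    by (simp add: vertex_position_def)
  have "{u \<in> S. u \<noteq> w \<and> (u, w) \<in> r} = insert v {u \<in> S - {v}. u \<noteq> w \<and> (u, w) \<in> r}"
    using vw le by auto
  then show "vertex_position r S w = Suc (vertex_position r (S - {v}) w)"
    using S by (simp add: vertex_position_def)
qed

lemma simplicial_boundary_sum:
  "finite I \<Longrightarrow> simplicial_boundary r (\<Sum>i\<in>I. f i) = (\<Sum>i\<in>I. simplicial_boundary r (f i))"
  unfolding simplicial_boundary_def by (induction I rule: finite_induct) (auto simp: frag_extend_add)

lemma simplicial_boundary_of: "simplicial_boundary r (frag_of S) = simplex_boundary r S"
  by (simp add: simplicial_boundary_def)

lemma simplicial_boundary_cmul:
  "simplicial_boundary r (frag_cmul c x) = frag_cmul c (simplicial_boundary r x)"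
  by (simp add: simplicial_boundary_def frag_extend_cmul)

lemma simplicial_boundary_simplex_boundary:
  assumes r: "linear_order_on A r" and S: "finite S" "S \<subseteq> A"
  shows "simplicial_boundary r (simplex_boundary r S) = 0"
proof -
  define f where "f v w = frag_cmul ((-1) ^ vertex_position r S v * (-1) ^ vertex_position r (S - {v}) w)
    (frag_of (S - {v} - {w}))" for v w
  let ?P = "Sigma S (\<lambda>v. S - {v})"
  have flip: "f v w = - f w v" if "v \<in> S" "w \<in> S" "v \<noteq> w" for v w
  proof -
    have *: "f v w = - f w v" if "v \<in> S" "w \<in> S" "v \<noteq> w" "(v, w) \<in> r" for v w
    proof -
      have "S - {v} - {w} = S - {w} - {v}"
        by auto
      with vertex_position_swap[OF r S that] show ?thesis
        by (simp add: f_def mult.commute)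
    qed
    have "(v, w) \<in> r \<or> (w, v) \<in> r"
      using r S that by (auto simp: linear_order_on_def total_on_def)
    then show ?thesis
      using *[of v w] *[of w v] that by auto
  qed
  have "simplicial_boundary r (simplex_boundary r S) = (\<Sum>v\<in>S. \<Sum>w\<in>S - {v}. f v w)"
    using S by (simp add: simplex_boundary_def[of r S] simplicial_boundary_sum simplicial_boundary_cmul
        simplicial_boundary_of)
      (simp add: simplex_boundary_def f_def frag_cmul_sum)
  also have "\<dots> = (\<Sum>(v, w)\<in>?P. f v w)"
    using S by (simp add: sum.Sigma)
  finally have eq: "simplicial_boundary r (simplex_boundary r S) = (\<Sum>(v, w)\<in>?P. f v w)" .
  have "(\<Sum>(v, w)\<in>?P. f v w) = (\<Sum>(v, w)\<in>?P. f w v)"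
    by (rule sum.reindex_bij_witness[of _ prod.swap prod.swap]) auto
  also have "\<dots> = (\<Sum>(v, w)\<in>?P. - f v w)"
    by (rule sum.cong) (auto intro: flip)
  also have "\<dots> = - (\<Sum>(v, w)\<in>?P. f v w)"
    by (simp add: case_prod_unfold sum_negf)
  finally have neg: "(\<Sum>(v, w)\<in>?P. f v w) = - (\<Sum>(v, w)\<in>?P. f v w)" .
  have "c = 0" if "c = - c" for c :: "'a set \<Rightarrow>\<^sub>0 int"
  proof (rule poly_mapping_eqI)
    fix T
    have "Poly_Mapping.lookup c T = - Poly_Mapping.lookup c T"
      using that by (metis lookup_uminus)
    then show "Poly_Mapping.lookup c T = Poly_Mapping.lookup 0 T"
      by simp
  qed
  with neg eq show ?thesis
    by metis
qed

section \<open>Clique complexes\<close>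

definition clique_complex :: "'a pair_pre_digraph \<Rightarrow> 'a set set" where
  "clique_complex G =
     {S. finite S \<and> S \<subseteq> pverts G \<and> (\<forall>x\<in>S. \<forall>y\<in>S. x \<noteq> y \<longrightarrow> (x, y) \<in> parcs G)}"

lemma abstract_simplicial_complex_clique_complex: "abstract_simplicial_complex (clique_complex G)"
  by (auto simp: abstract_simplicial_complex_def clique_complex_def intro: finite_subset)

section \<open>Commuting graphs of elements of prime order in symmetric groups\<close>

definition product_of_disjoint_cycles :: "nat \<Rightarrow> nat \<Rightarrow> nat \<Rightarrow> (nat \<Rightarrow> nat) \<Rightarrow> bool" where
  "product_of_disjoint_cycles p n a x \<longleftrightarrow>
     (\<exists>css. length css \<le> a \<and>
        (\<forall>cs\<in>set css. cycle cs \<and> length cs = p \<and> set cs \<subseteq> {1..n}) \<and>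
        pairwise (\<lambda>i j. set (css ! i) \<inter> set (css ! j) = {}) {..<length css} \<and>
        x = foldr (\<circ>) (map cycle_of_list css) id)"

definition Lambda_graph :: "nat \<Rightarrow> nat \<Rightarrow> nat \<Rightarrow> (nat \<Rightarrow> nat) pair_pre_digraph" where
  "Lambda_graph p n a =
     (let V = {x \<in> carrier (sym_group n).
                 group.ord (sym_group n) x = p \<and> product_of_disjoint_cycles p n a x}
      in \<lparr>pverts = V,
          parcs = {(x, y). x \<in> V \<and> y \<in> V \<and> x \<noteq> y \<and>
                     x \<otimes>\<^bsub>sym_group n\<^esub> y = y \<otimes>\<^bsub>sym_group n\<^esub> x}\<rparr>)"

definition K_complex :: "nat \<Rightarrow> nat \<Rightarrow> nat \<Rightarrow> (nat \<Rightarrow> nat) set set" where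
  "K_complex p n a = clique_complex (Lambda_graph p n a)"

lemma pair_graph_Lambda_graph: "pair_graph (Lambda_graph p n a)"
proof -
  let ?G = "Lambda_graph p n a"
  have fin: "finite (pverts ?G)"
    by (rule finite_subset[of _ "{x. x permutes {1..n}}"])
      (auto simp: Lambda_graph_def Let_def sym_group_def finite_permutations)
  have "parcs ?G \<subseteq> pverts ?G \<times> pverts ?G"
    by (auto simp: Lambda_graph_def Let_def)
  then have "finite (parcs ?G)"
    using fin by (meson finite_SigmaI finite_subset)
  moreover have "sym (parcs ?G)"
    by (auto simp: Lambda_graph_def Let_def sym_def)
  ultimately show ?thesis
    using fin by unfold_locales (auto simp: Lambda_graph_def Let_def symmetric_def)
qed

end

theory Submission
  imports Defs
begin

text \<open>
  Elements with disjoint supports commute, and a vertex moves at most \<open>a * p\<close> letters. Hence under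
  the bound on \<open>n\<close> any \<open>2 * k + 2\<close> vertices leave \<open>p\<close> letters unmoved, and a \<open>p\<close>-cycle on these
  letters commutes with all of them.

  A clique complex in which any \<open>2 * k + 2\<close> vertices have a common neighbour is \<open>k\<close>-acyclic: it is
  the union of the stars of its vertices, and an intersection of stars is the clique complex induced
  on the common closed neighbourhood \<open>C\<close> of their apexes. Passing to the intersection with one more
  star costs one of the available common neighbours. Adding the stars one at a time with
  Mayer--Vietoris lowers the degree by one and intersects with two stars, which explains the factor
  \<open>2\<close>, except in the first step, where the stars of vertices of \<open>C\<close> are cones.
\<close>

section \<open>Acyclicity on the level of chains\<close>

text \<open>Exactness of the augmented chain complex strictly below degree \<open>d\<close>, stated
  with chains instead of quotient groups so that fillings can be written down explicitly.
  \<open>k\<close>-acyclicity corresponds to \<open>d = k + 1\<close>.\<close>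

definition acyclic_below :: "'a rel \<Rightarrow> 'a set set \<Rightarrow> int \<Rightarrow> bool" where
  "acyclic_below r K d \<longleftrightarrow>
     (\<forall>t<d. \<forall>z. Poly_Mapping.keys z \<subseteq> simplices K t \<longrightarrow> simplicial_boundary r z = 0 \<longrightarrow>
        (\<exists>c. Poly_Mapping.keys c \<subseteq> simplices K (t + 1) \<and> simplicial_boundary r c = z))"

section \<open>Boundary maps on chains supported in a complex\<close>

lemma simplicial_boundary_add:
  "simplicial_boundary r (x + y) = simplicial_boundary r x + simplicial_boundary r y"
  by (simp add: simplicial_boundary_def frag_extend_add)

lemma simplicial_boundary_diff:
  "simplicial_boundary r (x - y) = simplicial_boundary r x - simplicial_boundary r y"
  by (simp add: simplicial_boundary_def frag_extend_diff)

lemma simplicial_boundary_zero [simp]: "simplicial_boundary r 0 = 0"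
  by (simp add: simplicial_boundary_def)

lemma keys_simplicial_boundary:
  assumes K: "abstract_simplicial_complex K" and c: "Poly_Mapping.keys c \<subseteq> simplices K t"
  shows "Poly_Mapping.keys (simplicial_boundary r c) \<subseteq> simplices K (t - 1)"
proof -
  have "Poly_Mapping.keys (simplex_boundary r S) \<subseteq> simplices K (t - 1)" if S: "S \<in> simplices K t" for S
  proof -
    have "Poly_Mapping.keys (simplex_boundary r S) \<subseteq> (\<Union>v\<in>S. {S - {v}})"
      unfolding simplex_boundary_def by (rule order_trans[OF keys_sum]) auto
    also have "\<dots> \<subseteq> simplices K (t - 1)"
    proof clarify
      fix v assume v: "v \<in> S"
      from S have "S \<in> K" "finite S" "int (card S) = t + 1"
        by (auto simp: simplices_def)
      moreover from this v have "card S = Suc (card (S - {v}))"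
        by (intro card.remove)
      ultimately show "S - {v} \<in> simplices K (t - 1)"
        using K unfolding simplices_def abstract_simplicial_complex_def by auto
    qed
    finally show ?thesis .
  qed
  then show ?thesis
    unfolding simplicial_boundary_def using c keys_frag_extend[of "simplex_boundary r" c] by blast
qed

text \<open>The order may live on a set \<open>A\<close> larger than the vertex set, so that one
  order serves a clique complex and all its subcomplexes.\<close>

lemma simplicial_boundary_boundary:
  assumes r: "linear_order_on A r" and K: "\<Union>K \<subseteq> A" and c: "Poly_Mapping.keys c \<subseteq> simplices K t"
  shows "simplicial_boundary r (simplicial_boundary r c) = 0"
  using c
proof (induction c rule: frag_induction)
  case (one S)
  then have "finite S" "S \<subseteq> A"
    using K by (auto simp: simplices_def)
  then show ?case
    using simplicial_boundary_simplex_boundary[OF r] by (simp add: simplicial_boundary_of)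
qed (simp_all add: simplicial_boundary_diff)

text \<open>When every cycle bounds, the homology group is the quotient of the group of cycles by
  itself.\<close>

lemma acyclic_below_imp_k_acyclic:
  assumes K: "abstract_simplicial_complex K"
    and ac: "\<And>r. linear_order_on (\<Union>K) r \<Longrightarrow> acyclic_below r K (k + 1)"
  shows "k_acyclic k K"
  unfolding k_acyclic_def
proof (intro allI impI)
  fix r t
  assume r: "linear_order_on (\<Union>K) r" and t: "t \<le> k"
  let ?C = "simplicial_chain_group K t" and ?D = "simplicial_chain_group K (t - 1)"
  let ?Z = "simplicial_cycles r K t"
  let ?G = "subgroup_generated ?C ?Z"
  interpret C: group ?C
    by (simp add: simplicial_chain_group_def)
  interpret hom: group_hom ?C ?D "simplicial_boundary r"
  proof (intro group_hom.intro group_hom_axioms.intro)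
    show "Group.group ?C" "Group.group ?D"
      by (simp_all add: simplicial_chain_group_def)
    show "simplicial_boundary r \<in> hom ?C ?D"
      using keys_simplicial_boundary[OF K]
      by (auto simp: hom_def simplicial_chain_group_def simplicial_boundary_add)
  qed
  have Z: "subgroup ?Z ?C"
    unfolding simplicial_cycles_def by (rule hom.subgroup_kernel)
  \<comment> \<open>The cycles already form a subgroup, so generating one from them adds
    nothing.\<close>
  have carr: "carrier ?G = ?Z"
    using Z by (metis C.subgroup_generated_minimal C.subgroup_generated_subset_carrier_subset
        order_refl subgroup.subset subset_antisym)
  have "simplicial_boundaries r K t = ?Z"
  proof
    show "simplicial_boundaries r K t \<subseteq> ?Z"
    proof
      fix x assume "x \<in> simplicial_boundaries r K t"
      then obtain c where c: "Poly_Mapping.keys c \<subseteq> simplices K (t + 1)" and x: "x = simplicial_boundary r c"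
        by (auto simp: simplicial_boundaries_def simplicial_chain_group_def)
      have "Poly_Mapping.keys x \<subseteq> simplices K t"
        using keys_simplicial_boundary[OF K c, of r] x by simp
      moreover have "simplicial_boundary r x = 0"
        unfolding x by (rule simplicial_boundary_boundary[OF r order_refl c])
      ultimately show "x \<in> ?Z"
        by (simp add: simplicial_cycles_def kernel_def simplicial_chain_group_def)
    qed
    show "?Z \<subseteq> simplicial_boundaries r K t"
    proof
      fix z assume "z \<in> ?Z"
      have "t < k + 1"
        using t by simp
      from \<open>z \<in> ?Z\<close>
      have "Poly_Mapping.keys z \<subseteq> simplices K t" "simplicial_boundary r z = 0"
        by (simp_all add: simplicial_cycles_def kernel_def simplicial_chain_group_def)
      then obtain c where "Poly_Mapping.keys c \<subseteq> simplices K (t + 1)" "simplicial_boundary r c = z"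
        using ac[OF r] \<open>t < k + 1\<close> unfolding acyclic_below_def by blast
      then show "z \<in> simplicial_boundaries r K t"
        by (auto simp: simplicial_boundaries_def simplicial_chain_group_def)
    qed
  qed
  with carr have B: "simplicial_boundaries r K t = carrier ?G"
    by simp
  interpret G: comm_group ?G
    by (rule C.abelian_subgroup_generated)
      (simp add: simplicial_chain_group_def abelian_free_Abelian_group)
  have "carrier ?G \<lhd> ?G"
    using G.normal_iff_subgroup G.subgroup_self by blast
  then have "Group.group (?G Mod carrier ?G)"
    by (rule normal.factorgroup_is_group)
  moreover have "carrier (?G Mod carrier ?G) \<subseteq> {carrier ?G}"
    by (auto simp: FactGroup_def RCOSETS_def G.coset_join2[OF _ G.subgroup_self])
  ultimately show "trivial_group (reduced_simplicial_homology r K t)"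
    unfolding reduced_simplicial_homology_def B using group.trivial_group_alt by blast
qed

section \<open>Criteria for acyclicity: low degrees, unions, cones\<close>

lemma acyclic_below_negative:
  assumes "d \<le> -1"
  shows "acyclic_below r K d"
  unfolding acyclic_below_def
proof (intro allI impI)
  fix t and z :: "'a set \<Rightarrow>\<^sub>0 int"
  assume t: "t < d" and z: "Poly_Mapping.keys z \<subseteq> simplices K t"
  \<comment> \<open>Here \<open>t \<le> -2\<close>, so a simplex would have negative cardinality;
    the empty simplex sits just above, in degree -1.\<close>
  have "simplices K t = {}"
    using t assms by (auto simp: simplices_def)
  with z have "z = 0"
    by simp
  then show "\<exists>c. Poly_Mapping.keys c \<subseteq> simplices K (t + 1) \<and> simplicial_boundary r c = z"
    by (intro exI[of _ 0]) simp
qed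

text \<open>The Mayer--Vietoris argument: a cycle of the union splits as \<open>x + y\<close>, the
  boundary of \<open>x\<close> is a cycle of the intersection one degree lower, and filling it there
  by \<open>c\<close> yields the cycles \<open>x - c\<close> and \<open>y + c\<close>.\<close>

lemma acyclic_below_Un:
  assumes r: "linear_order_on A r" and KA: "\<Union>K \<subseteq> A"
    and K: "abstract_simplicial_complex K" and L: "abstract_simplicial_complex L"
    and acK: "acyclic_below r K d" and acL: "acyclic_below r L d"
    and acKL: "acyclic_below r (K \<inter> L) (d - 1)"
  shows "acyclic_below r (K \<union> L) d"
  unfolding acyclic_below_def
proof (intro allI impI)
  fix t and z :: "'a set \<Rightarrow>\<^sub>0 int"
  assume t: "t < d" and z: "Poly_Mapping.keys z \<subseteq> simplices (K \<union> L) t" and bz: "simplicial_boundary r z = 0"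
  have Un: "simplices (K \<union> L) s = simplices K s \<union> simplices L s" for s
    by (auto simp: simplices_def)
  have Int: "simplices (K \<inter> L) s = simplices K s \<inter> simplices L s" for s
    by (auto simp: simplices_def)
  obtain x y where x: "Poly_Mapping.keys x \<subseteq> simplices K t" and y: "Poly_Mapping.keys y \<subseteq> simplices L t"
    and xy: "x + y = z"
    using frag_split z Un by metis
  have bxy: "simplicial_boundary r x = - simplicial_boundary r y"
    using bz xy by (metis simplicial_boundary_add add_eq_0_iff2)
  \<comment> \<open>Up to sign this is also the boundary of \<open>y\<close>, hence it is supported
    in both complexes.\<close>
  have "Poly_Mapping.keys (simplicial_boundary r x) \<subseteq> simplices (K \<inter> L) (t - 1)"
    using keys_simplicial_boundary[OF K x, of r] keys_simplicial_boundary[OF L y, of r] bxy Int by simp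
  moreover have "simplicial_boundary r (simplicial_boundary r x) = 0"
    by (rule simplicial_boundary_boundary[OF r KA x])
  ultimately obtain c where c: "Poly_Mapping.keys c \<subseteq> simplices (K \<inter> L) t"
    and bc: "simplicial_boundary r c = simplicial_boundary r x"
    using acKL t unfolding acyclic_below_def by (metis diff_add_cancel diff_strict_right_mono)
  have "Poly_Mapping.keys (x - c) \<subseteq> simplices K t"
    using x c Int keys_diff[of x c] by blast
  moreover have "simplicial_boundary r (x - c) = 0"
    by (simp add: simplicial_boundary_diff bc)
  ultimately obtain e where e: "Poly_Mapping.keys e \<subseteq> simplices K (t + 1)" "simplicial_boundary r e = x - c"
    using acK t unfolding acyclic_below_def by blast
  have "Poly_Mapping.keys (y + c) \<subseteq> simplices L t"
    using y c Int keys_add[of y c] by blast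
  moreover have "simplicial_boundary r (y + c) = 0"
    by (simp add: simplicial_boundary_add bc bxy)
  ultimately obtain f where f: "Poly_Mapping.keys f \<subseteq> simplices L (t + 1)" "simplicial_boundary r f = y + c"
    using acL t unfolding acyclic_below_def by blast
  show "\<exists>c. Poly_Mapping.keys c \<subseteq> simplices (K \<union> L) (t + 1) \<and> simplicial_boundary r c = z"
  proof (intro exI conjI)
    show "Poly_Mapping.keys (e + f) \<subseteq> simplices (K \<union> L) (t + 1)"
      using e f keys_add[of e f] Un by blast
    show "simplicial_boundary r (e + f) = z"
      using e f xy by (simp add: simplicial_boundary_add)
  qed
qed

text \<open>The contracting homotopy joins simplices with the apex \<open>w\<close>.\<close>

lemma acyclic_below_cone:
  assumes r: "linear_order_on A r" and KA: "\<Union>K \<subseteq> A"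
    and cone: "\<And>S. S \<in> K \<Longrightarrow> insert w S \<in> K"
  shows "acyclic_below r K d"
proof -
  define sg :: "'a set \<Rightarrow> 'a \<Rightarrow> int" where "sg S v = (-1) ^ vertex_position r S v" for S v
  \<comment> \<open>The sign is the one with which deleting \<open>w\<close> from
    \<open>insert w S\<close> returns \<open>S\<close>, so the face opposite to the apex gets
    coefficient 1.\<close>
  define h where "h S = (if w \<in> S then 0 else frag_cmul (sg (insert w S) w) (frag_of (insert w S)))" for S
  have sg2: "sg S v * sg S v = 1" for S v
    by (simp add: sg_def flip: power_mult_distrib)
  have bd: "simplicial_boundary r (frag_of S) = (\<Sum>v\<in>S. frag_cmul (sg S v) (frag_of (S - {v})))" for S
    by (simp add: simplicial_boundary_of simplex_boundary_def sg_def)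
  have homotopy: "simplicial_boundary r (h S) + frag_extend h (simplicial_boundary r (frag_of S)) = frag_of S"
    if S: "S \<in> K" "finite S" for S
  proof (cases "w \<in> S")
    case True
    have "frag_extend h (simplicial_boundary r (frag_of S)) = (\<Sum>v\<in>S. frag_cmul (sg S v) (h (S - {v})))"
      using S by (simp add: bd frag_extend_sum frag_extend_cmul o_def)
    \<comment> \<open>All faces but \<open>S - {w}\<close> still contain \<open>w\<close> and are
      killed by \<open>h\<close>.\<close>
    also have "\<dots> = (\<Sum>v\<in>{w}. frag_cmul (sg S v) (h (S - {v})))"
      using S True by (intro sum.mono_neutral_right) (auto simp: h_def)
    also have "\<dots> = frag_of S"
      using True by (simp add: h_def insert_absorb sg2)
    finally show ?thesis
      using True by (simp add: h_def)
  next
    case False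
    let ?T = "insert w S"
    have T: "finite ?T" "?T \<subseteq> A"
      using S KA cone[of S] by auto
    \<comment> \<open>Removing \<open>v\<close> and \<open>w\<close> in the two possible orders
      gives opposite signs: only the later of the two changes position when the other is
      gone.\<close>
    have sign: "sg ?T w * sg ?T v = - (sg S v * sg (?T - {v}) w)" if v: "v \<in> S" for v
    proof -
      have "v \<noteq> w" and Tw: "?T - {w} = S"
        using False v by auto
      have "(v, w) \<in> r \<or> (w, v) \<in> r"
        using r T v \<open>v \<noteq> w\<close> by (auto simp: linear_order_on_def total_on_def)
      then show ?thesis
        using vertex_position_swap[OF r T, of v w] vertex_position_swap[OF r T, of w v] v \<open>v \<noteq> w\<close>
        unfolding sg_def Tw by auto
    qed
    have "simplicial_boundary r (h S) =
        (\<Sum>v\<in>?T. frag_cmul (sg ?T w * sg ?T v) (frag_of (?T - {v})))"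
      using False by (simp add: h_def simplicial_boundary_cmul bd frag_cmul_sum)
    also have "\<dots> = frag_of S + (\<Sum>v\<in>S. frag_cmul (sg ?T w * sg ?T v) (frag_of (?T - {v})))"
      using S False by (simp add: sg2)
    also have "(\<Sum>v\<in>S. frag_cmul (sg ?T w * sg ?T v) (frag_of (?T - {v}))) =
        - (\<Sum>v\<in>S. frag_cmul (sg S v * sg (?T - {v}) w) (frag_of (?T - {v})))"
      by (simp add: sign flip: sum_negf)
    also have "(\<Sum>v\<in>S. frag_cmul (sg S v * sg (?T - {v}) w) (frag_of (?T - {v}))) =
        (\<Sum>v\<in>S. frag_cmul (sg S v) (h (S - {v})))"
      using False by (intro sum.cong) (auto simp: h_def insert_Diff_if)
    also have "\<dots> = frag_extend h (simplicial_boundary r (frag_of S))"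
      using S by (simp add: bd frag_extend_sum frag_extend_cmul o_def)
    finally show ?thesis
      by simp
  qed
  \<comment> \<open>The identity extends linearly to chains; on a cycle the second summand vanishes,
    so that \<open>frag_extend h z\<close> fills \<open>z\<close>.\<close>
  have H: "simplicial_boundary r (frag_extend h z) + frag_extend h (simplicial_boundary r z) = z"
    if "Poly_Mapping.keys z \<subseteq> simplices K t" for z t
    using that
  proof (induction z rule: frag_induction)
    case (one S)
    then show ?case
      using homotopy[of S] by (simp add: simplices_def)
  next
    case (diff x y)
    have "simplicial_boundary r (frag_extend h (x - y)) + frag_extend h (simplicial_boundary r (x - y)) =
      (simplicial_boundary r (frag_extend h x) + frag_extend h (simplicial_boundary r x)) -
      (simplicial_boundary r (frag_extend h y) + frag_extend h (simplicial_boundary r y))"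
      by (simp add: simplicial_boundary_diff frag_extend_diff)
    then show ?case
      by (simp only: diff)
  qed simp
  show ?thesis
    unfolding acyclic_below_def
  proof (intro allI impI)
    fix t and z :: "'a set \<Rightarrow>\<^sub>0 int"
    assume z: "Poly_Mapping.keys z \<subseteq> simplices K t" and bz: "simplicial_boundary r z = 0"
    have "Poly_Mapping.keys (h S) \<subseteq> simplices K (t + 1)" if "S \<in> simplices K t" for S
      using that cone[of S] by (auto simp: h_def simplices_def)
    then have "Poly_Mapping.keys (frag_extend h z) \<subseteq> simplices K (t + 1)"
      using z keys_frag_extend[of h z] by blast
    moreover have "simplicial_boundary r (frag_extend h z) = z"
      using H[OF z] bz by simp
    ultimately show "\<exists>c. Poly_Mapping.keys c \<subseteq> simplices K (t + 1) \<and> simplicial_boundary r c = z"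
      by blast
  qed
qed

section \<open>Graphs in which few vertices always have a common neighbour\<close>

definition induced_clique_complex :: "'a pair_pre_digraph \<Rightarrow> 'a set \<Rightarrow> 'a set set" where
  "induced_clique_complex G C = {S \<in> clique_complex G. S \<subseteq> C}"

definition closed_nbhd :: "'a pair_pre_digraph \<Rightarrow> 'a \<Rightarrow> 'a set" where
  "closed_nbhd G w = insert w {x. (w, x) \<in> parcs G}"

text \<open>\<open>U\<close> ranges over all vertices of \<open>G\<close>, not only those in
  \<open>C\<close>, so that \<open>C\<close> can be cut down to the neighbourhood of any vertex. For
  \<open>U = {}\<close> the condition says that \<open>C\<close> is nonempty.\<close>

definition common_nbrs_in :: "'a pair_pre_digraph \<Rightarrow> 'a set \<Rightarrow> nat \<Rightarrow> bool" where
  "common_nbrs_in G C m \<longleftrightarrow>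
     (\<forall>U\<subseteq>pverts G. finite U \<longrightarrow> card U \<le> m \<longrightarrow> (\<exists>c\<in>C. \<forall>u\<in>U. c \<in> closed_nbhd G u))"

lemma abstract_simplicial_complex_induced: "abstract_simplicial_complex (induced_clique_complex G C)"
  using abstract_simplicial_complex_clique_complex[of G]
  by (auto simp: abstract_simplicial_complex_def induced_clique_complex_def)

lemma abstract_simplicial_complex_UN:
  "W \<noteq> {} \<Longrightarrow> (\<And>w. w \<in> W \<Longrightarrow> abstract_simplicial_complex (K w)) \<Longrightarrow>
    abstract_simplicial_complex (\<Union>w\<in>W. K w)"
  unfolding abstract_simplicial_complex_def by blast

lemma common_nbrs_inD:
  "common_nbrs_in G C m \<Longrightarrow> U \<subseteq> pverts G \<Longrightarrow> finite U \<Longrightarrow> card U \<le> m \<Longrightarrow>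
    \<exists>c\<in>C. \<forall>u\<in>U. c \<in> closed_nbhd G u"
  by (simp add: common_nbrs_in_def)

text \<open>The vertex \<open>w\<close> joins \<open>U\<close> as one of the \<open>Suc m\<close>
  vertices allowed; hence the loss of one.\<close>

lemma common_nbrs_in_closed_nbhd:
  assumes C: "common_nbrs_in G C (Suc m)" and w: "w \<in> pverts G"
  shows "common_nbrs_in G (C \<inter> closed_nbhd G w) m"
  unfolding common_nbrs_in_def
proof (intro allI impI)
  fix U assume U: "U \<subseteq> pverts G" "finite U" "card U \<le> m"
  then have "insert w U \<subseteq> pverts G" "finite (insert w U)" "card (insert w U) \<le> Suc m"
    using w by (auto simp: card_insert_if)
  from common_nbrs_inD[OF C this] obtain c where "c \<in> C" "\<forall>u\<in>insert w U. c \<in> closed_nbhd G u" ..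
  then show "\<exists>c\<in>C \<inter> closed_nbhd G w. \<forall>u\<in>U. c \<in> closed_nbhd G u"
    by (intro bexI[of _ c]) auto
qed

lemma finite_pverts_pair_graph:
  assumes "pair_graph G"
  shows "finite (pverts G)"
proof -
  interpret pair_graph G
    by (rule assms)
  show ?thesis
    by (rule pair_finite_verts)
qed

lemma Union_induced_clique_complex: "\<Union>(induced_clique_complex G C) \<subseteq> pverts G"
  by (auto simp: induced_clique_complex_def clique_complex_def)

section \<open>Covering a clique complex by stars\<close>

lemma induced_clique_complex_UN_stars:
  assumes "C \<noteq> {}"
  shows "induced_clique_complex G C = (\<Union>w\<in>C. induced_clique_complex G (C \<inter> closed_nbhd G w))"
proof (intro equalityI subsetI)
  fix S assume S: "S \<in> induced_clique_complex G C"
  show "S \<in> (\<Union>w\<in>C. induced_clique_complex G (C \<inter> closed_nbhd G w))"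
  \<comment> \<open>A nonempty clique lies in the star of any of its vertices; the empty one lies in
    every star, and there is a star because \<open>C \<noteq> {}\<close>.\<close>
  proof (cases "S = {}")
    case True
    then show ?thesis
      using S assms by (auto simp: induced_clique_complex_def)
  next
    case False
    then obtain w where w: "w \<in> S"
      by blast
    with S have "w \<in> C"
      by (auto simp: induced_clique_complex_def)
    moreover have "S \<subseteq> closed_nbhd G w"
      using S w by (auto simp: induced_clique_complex_def clique_complex_def closed_nbhd_def)
    ultimately show ?thesis
      using S by (auto simp: induced_clique_complex_def)
  qed
qed (auto simp: induced_clique_complex_def)

text \<open>The stars are added one at a time by \<open>acyclic_below_Un\<close>. A new star meets
  the union of the earlier ones in a union of intersections of two stars, where acyclicity one
  degree lower is enough; \<open>W'\<close> stands for the apexes already treated.\<close>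

lemma acyclic_below_UN_stars:
  assumes r: "linear_order_on (pverts G) r" and W: "finite W" "W \<noteq> {}"
    and star: "\<And>w. w \<in> W \<Longrightarrow> acyclic_below r (induced_clique_complex G (C \<inter> closed_nbhd G w)) d"
    and double: "\<And>w W'. w \<in> W \<Longrightarrow> W' \<subseteq> W \<Longrightarrow> W' \<noteq> {} \<Longrightarrow>
      acyclic_below r (\<Union>w'\<in>W'. induced_clique_complex G (C \<inter> closed_nbhd G w \<inter> closed_nbhd G w')) (d - 1)"
  shows "acyclic_below r (\<Union>w\<in>W. induced_clique_complex G (C \<inter> closed_nbhd G w)) d"
  using W star double
proof (induction W rule: finite_ne_induct)
  case (singleton w)
  then show ?case
    by simp
next
  case (insert w W)
  let ?S = "\<lambda>w. induced_clique_complex G (C \<inter> closed_nbhd G w)"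
  have "?S w \<inter> (\<Union>w'\<in>W. ?S w') =
      (\<Union>w'\<in>W. induced_clique_complex G (C \<inter> closed_nbhd G w \<inter> closed_nbhd G w'))"
    by (auto simp: induced_clique_complex_def)
  then have int: "acyclic_below r (?S w \<inter> (\<Union>w'\<in>W. ?S w')) (d - 1)"
    using insert.prems(2)[of w W] insert.hyps by (simp add: subset_insertI)
  have IH: "acyclic_below r (\<Union>w'\<in>W. ?S w') d"
    using insert.prems by (intro insert.IH) (meson insertI2 subset_insertI2)+
  have "acyclic_below r (?S w \<union> (\<Union>w'\<in>W. ?S w')) d"
    by (rule acyclic_below_Un[OF r Union_induced_clique_complex])
      (use IH int insert.prems(1) insert.hyps in
        \<open>auto intro!: abstract_simplicial_complex_induced abstract_simplicial_complex_UN\<close>)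
  then show ?case
    by simp
qed

text \<open>As \<open>w\<close> lies in \<open>C\<close> and is adjacent to all other vertices of
  the complex, the complex is a cone with apex \<open>w\<close>.\<close>

lemma acyclic_below_star:
  assumes G: "pair_graph G" and r: "linear_order_on (pverts G) r" and w: "w \<in> C" "w \<in> pverts G"
  shows "acyclic_below r (induced_clique_complex G (C \<inter> closed_nbhd G w)) d"
proof (rule acyclic_below_cone[OF r, where w = w])
  interpret pair_graph G
    by (rule G)
  show "\<Union>(induced_clique_complex G (C \<inter> closed_nbhd G w)) \<subseteq> pverts G"
    by (rule Union_induced_clique_complex)
  fix S assume S: "S \<in> induced_clique_complex G (C \<inter> closed_nbhd G w)"
  then have "\<forall>x\<in>S. x \<noteq> w \<longrightarrow> (w, x) \<in> parcs G"
    by (auto simp: induced_clique_complex_def closed_nbhd_def)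
  moreover from this have "\<forall>x\<in>S. x \<noteq> w \<longrightarrow> (x, w) \<in> parcs G"
    using arcs_symmetric by simp
  ultimately show "insert w S \<in> induced_clique_complex G (C \<inter> closed_nbhd G w)"
    using S w by (simp add: induced_clique_complex_def clique_complex_def closed_nbhd_def)
qed

text \<open>
  The degrees are shifted by two (\<open>e = d + 2\<close> for \<open>d\<close>-acyclicity), so that the induction starts with
  degrees in which there are no simplices. In the second statement the apexes \<open>w\<close> need not lie in
  \<open>C\<close>; the stars are then not cones, which costs one more common neighbour.
\<close>

lemma acyclic_below_common_nbrs:
  assumes G: "pair_graph G" and r: "linear_order_on (pverts G) r"
  shows "\<lbrakk>C \<subseteq> pverts G; common_nbrs_in G C m; 2 * e \<le> m + 2\<rbrakk> \<Longrightarrow>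
      acyclic_below r (induced_clique_complex G C) (int e - 1)"
    and "\<lbrakk>C \<subseteq> pverts G; common_nbrs_in G C m; 2 * e \<le> m + 1; W \<subseteq> pverts G; W \<noteq> {}\<rbrakk> \<Longrightarrow>
      acyclic_below r (\<Union>w\<in>W. induced_clique_complex G (C \<inter> closed_nbhd G w)) (int e - 1)"
proof (induction e arbitrary: C m W)
  case 0
  {
    case 1
    then show ?case
      by (simp add: acyclic_below_negative)
  next
    case 2
    then show ?case
      by (simp add: acyclic_below_negative)
  }
next
  case (Suc e)
  have fin: "finite (pverts G)"
    using G by (rule finite_pverts_pair_graph)
  \<comment> \<open>Intersecting with the star of \<open>w\<close> lowers \<open>m\<close> to
    \<open>m'\<close>, and \<open>2 * Suc e \<le> m + 2\<close> becomes
    \<open>2 * e \<le> m' + 1\<close>, as the second induction hypothesis demands.\<close>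
  have double: "acyclic_below r
      (\<Union>w'\<in>W'. induced_clique_complex G (C \<inter> closed_nbhd G w \<inter> closed_nbhd G w')) (int (Suc e) - 1 - 1)"
    if C: "C \<subseteq> pverts G" "common_nbrs_in G C m" and m: "2 * Suc e \<le> m + 2"
      and W': "w \<in> pverts G" "W' \<subseteq> pverts G" "W' \<noteq> {}" for C m w W'
  proof (cases m)
    \<comment> \<open>\<open>m = 0\<close> forces \<open>e = 0\<close>, and then only degrees below
      -1 are concerned.\<close>
    case 0
    then show ?thesis
      using m by (intro acyclic_below_negative) simp
  next
    case (Suc m')
    have "acyclic_below r
      (\<Union>w'\<in>W'. induced_clique_complex G (C \<inter> closed_nbhd G w \<inter> closed_nbhd G w')) (int e - 1)"
      by (rule Suc.IH(2)[of _ m']) (use C m W' Suc common_nbrs_in_closed_nbhd[of G C m' w] in auto)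
    then show ?thesis
      by simp
  qed
  \<comment> \<open>Kept general in \<open>C\<close> and \<open>m\<close>: besides the first claim
    it also supplies the single stars in the second.\<close>
  have all: "acyclic_below r (induced_clique_complex G C) (int (Suc e) - 1)"
    if C: "C \<subseteq> pverts G" "common_nbrs_in G C m" and m: "2 * Suc e \<le> m + 2" for C m
  proof -
    have "C \<noteq> {}"
      using common_nbrs_inD[OF C(2), of "{}"] by auto
    have "induced_clique_complex G C = (\<Union>w\<in>C. induced_clique_complex G (C \<inter> closed_nbhd G w))"
      by (rule induced_clique_complex_UN_stars) fact
    moreover have "acyclic_below r (\<Union>w\<in>C. induced_clique_complex G (C \<inter> closed_nbhd G w)) (int (Suc e) - 1)"
    proof (rule acyclic_below_UN_stars[OF r])
      show "finite C"
        using C(1) fin by (rule finite_subset)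
      show "acyclic_below r (induced_clique_complex G (C \<inter> closed_nbhd G w)) (int (Suc e) - 1)" if "w \<in> C" for w
        by (rule acyclic_below_star[OF G r]) (use that C in auto)
      show "acyclic_below r
          (\<Union>w'\<in>W'. induced_clique_complex G (C \<inter> closed_nbhd G w \<inter> closed_nbhd G w')) (int (Suc e) - 1 - 1)"
        if "w \<in> C" "W' \<subseteq> C" "W' \<noteq> {}" for w W'
        by (rule double[OF C m]) (use that C in auto)
    qed fact
    ultimately show ?thesis
      by simp
  qed
  {
    case 1
    then show ?case
      by (rule all)
  next
    case 2
    \<comment> \<open>One common neighbour is spent on the apex of a star; \<open>m'\<close> is what
      remains for applying \<open>all\<close> to that star.\<close>
    then obtain m' where m': "m = Suc m'" "2 * Suc e \<le> m' + 2"
      by (cases m) auto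
    show ?case
    proof (rule acyclic_below_UN_stars[OF r])
      show "finite W" "W \<noteq> {}"
        using 2 fin finite_subset by auto
      show "acyclic_below r (induced_clique_complex G (C \<inter> closed_nbhd G w)) (int (Suc e) - 1)" if "w \<in> W" for w
        by (rule all[of _ m']) (use 2 m' that common_nbrs_in_closed_nbhd[of G C m' w] in auto)
      show "acyclic_below r
          (\<Union>w'\<in>W'. induced_clique_complex G (C \<inter> closed_nbhd G w \<inter> closed_nbhd G w')) (int (Suc e) - 1 - 1)"
        if "w \<in> W" "W' \<subseteq> W" "W' \<noteq> {}" for w W'
        by (rule double[of _ m]) (use 2 that in auto)
    qed
  }
qed

text \<open>The case \<open>e = k + 2\<close>, \<open>m = 2 * k + 2\<close>,
  \<open>C = pverts G\<close> of the induction, in which \<open>2 * e \<le> m + 2\<close> is an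
  equality.\<close>

theorem k_acyclic_clique_complex:
  assumes G: "pair_graph G"
    and nbr: "\<And>U. U \<subseteq> pverts G \<Longrightarrow> card U \<le> 2 * k + 2 \<Longrightarrow> \<exists>c\<in>pverts G. \<forall>u\<in>U. c = u \<or> (u, c) \<in> parcs G"
  shows "k_acyclic (int k) (clique_complex G)"
proof (rule acyclic_below_imp_k_acyclic)
  show "abstract_simplicial_complex (clique_complex G)"
    by (rule abstract_simplicial_complex_clique_complex)
  fix r assume r: "linear_order_on (\<Union>(clique_complex G)) r"
  \<comment> \<open>Single vertices are cliques, so an order on the vertices of the complex is one
    on those of the graph.\<close>
  have "\<Union>(clique_complex G) = pverts G"
  proof
    show "\<Union>(clique_complex G) \<subseteq> pverts G"
      by (auto simp: clique_complex_def)
    show "pverts G \<subseteq> \<Union>(clique_complex G)"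
    proof
      fix x assume "x \<in> pverts G"
      then have "{x} \<in> clique_complex G"
        by (auto simp: clique_complex_def)
      then show "x \<in> \<Union>(clique_complex G)"
        by blast
    qed
  qed
  with r have r: "linear_order_on (pverts G) r"
    by simp
  have "common_nbrs_in G (pverts G) (2 * k + 2)"
    unfolding common_nbrs_in_def closed_nbhd_def using nbr by auto
  then have "acyclic_below r (induced_clique_complex G (pverts G)) (int (k + 2) - 1)"
    by (intro acyclic_below_common_nbrs(1)[OF G r]) auto
  moreover have "induced_clique_complex G (pverts G) = clique_complex G"
    by (auto simp: induced_clique_complex_def clique_complex_def)
  ultimately show "acyclic_below r (clique_complex G) (int k + 1)"
    by (simp add: add.commute)
qed

section \<open>Commuting elements with disjoint supports\<close>

text \<open>Each cycle moves at most \<open>p\<close> letters, so the union of the underlying lists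
  serves as \<open>B\<close>.\<close>

lemma product_of_disjoint_cycles_support:
  assumes "product_of_disjoint_cycles p n a x"
  obtains B where "finite B" "card B \<le> a * p" "x permutes B"
proof -
  have aux: "(foldr (\<circ>) (map cycle_of_list css) id) permutes (\<Union>cs\<in>set css. set cs) \<and>
      card (\<Union>cs\<in>set css. set cs) \<le> length css * p"
    if "\<forall>cs\<in>set css. length cs = p" for css :: "nat list list"
    using that
  proof (induction css)
    case Nil
    then show ?case
      by (simp add: permutes_id[unfolded id_def] id_def)
  next
    case (Cons cs css)
    let ?B = "\<Union>cs\<in>set css. set cs"
    have IH: "foldr (\<circ>) (map cycle_of_list css) id permutes ?B" "card ?B \<le> length css * p"
      using Cons.IH Cons.prems by (metis list.set_intros(2))+
    have "card (set cs \<union> ?B) \<le> p + length css * p"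
      using Cons.prems IH(2) card_Un_le[of "set cs" ?B] card_length[of cs] by fastforce
    moreover have "(cycle_of_list cs \<circ> foldr (\<circ>) (map cycle_of_list css) id) permutes (set cs \<union> ?B)"
    proof (rule permutes_compose)
      show "foldr (\<circ>) (map cycle_of_list css) id permutes (set cs \<union> ?B)"
        using IH(1) by (rule permutes_subset) auto
      show "cycle_of_list cs permutes (set cs \<union> ?B)"
        by (rule permutes_subset[OF cycle_permutes]) auto
    qed
    moreover have "foldr (\<circ>) (map cycle_of_list (cs # css)) id =
        cycle_of_list cs \<circ> foldr (\<circ>) (map cycle_of_list css) id"
      by simp
    ultimately show ?case
      by (simp only: list.set UN_insert list.size mult_Suc add_0_right add_Suc_right)
  qed
  from assms obtain css where css: "length css \<le> a" "\<forall>cs\<in>set css. length cs = p"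
    "x = foldr (\<circ>) (map cycle_of_list css) id"
    by (auto simp: product_of_disjoint_cycles_def)
  show ?thesis
  proof
    show "finite (\<Union>cs\<in>set css. set cs)"
      by simp
    show "card (\<Union>cs\<in>set css. set cs) \<le> a * p"
      using aux[OF css(2)] css(1) by (meson le_trans mult_le_mono1)
    show "x permutes (\<Union>cs\<in>set css. set cs)"
      using aux[OF css(2)] css(3) by simp
  qed
qed

text \<open>A point lies in at most one of the two sets, and each permutation preserves its own set
  and fixes everything outside.\<close>

lemma permutes_disjoint_commute:
  assumes f: "f permutes A" and g: "g permutes B" and disj: "A \<inter> B = {}"
  shows "f \<circ> g = g \<circ> f"
proof
  fix x
  show "(f \<circ> g) x = (g \<circ> f) x"
    using permutes_in_image[OF f, of x] permutes_in_image[OF g, of x]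
      permutes_not_in[OF f, of x] permutes_not_in[OF g, of x]
      permutes_not_in[OF f, of "g x"] permutes_not_in[OF g, of "f x"] disj
    by (cases "x \<in> A"; cases "x \<in> B") (auto simp: disjoint_iff)
qed

text \<open>The \<open>p\<close>-th power is the identity, so the order divides \<open>p\<close>; it
  is not 1 because a cycle of length at least 2 moves a letter.\<close>

lemma ord_prime_cycle:
  assumes p: "prime p" and cs: "cycle cs" "length cs = p" "set cs \<subseteq> {1..n}"
  shows "cycle_of_list cs \<in> carrier (sym_group n)" and "group.ord (sym_group n) (cycle_of_list cs) = p"
proof -
  interpret S: group "sym_group n"
    by (rule sym_group_is_group)
  let ?c = "cycle_of_list cs"
  show c: "?c \<in> carrier (sym_group n)"
    using cs permutes_subset[OF cycle_permutes] by (simp add: sym_group_carrier)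
  have pow: "?c [^]\<^bsub>sym_group n\<^esub> k = ?c ^^ k" for k :: nat
    by (induction k) (simp_all add: sym_group_def funpow_swap1 fun_eq_iff)
  have "S.ord ?c dvd p"
    using cycle_is_id_root[OF cs(1)] c cs(2) by (simp add: pow sym_group_one flip: S.pow_eq_id)
  moreover have "?c \<noteq> id"
  proof
    assume "?c = id"
    \<comment> \<open>The cycle maps the list \<open>cs\<close> entrywise to its rotation, whose
      first entry is the second entry of \<open>cs\<close>.\<close>
    then have "rotate1 cs = cs"
      using cyclic_rotation[OF cs(1), of 1] by simp
    moreover obtain x y zs where "cs = x # y # zs"
      using prime_ge_2_nat[OF p] cs(2) by (auto simp: Suc_le_length_iff numeral_2_eq_2)
    ultimately show False
      using cs(1) by simp
  qed
  then have "S.ord ?c \<noteq> 1"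
    using S.ord_eq_1[OF c] by (simp add: sym_group_one)
  ultimately show "S.ord ?c = p"
    using p by (metis prime_nat_iff)
qed

lemma Lambda_graph_common_neighbour:
  assumes p: "prime p" and a: "a \<ge> 1" and U: "U \<subseteq> pverts (Lambda_graph p n a)" "card U \<le> m"
    and n: "m * (a * p) + p \<le> n"
  shows "\<exists>c\<in>pverts (Lambda_graph p n a). \<forall>u\<in>U. c = u \<or> (u, c) \<in> parcs (Lambda_graph p n a)"
proof -
  have finU: "finite U"
    using U(1) finite_pverts_pair_graph[OF pair_graph_Lambda_graph] by (rule finite_subset)
  have "\<exists>B. finite B \<and> card B \<le> a * p \<and> u permutes B" if "u \<in> U" for u
  proof -
    have "product_of_disjoint_cycles p n a u"
      using U(1) that by (auto simp: Lambda_graph_def Let_def)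
    then show ?thesis
      by (rule product_of_disjoint_cycles_support) blast
  qed
  then obtain B where B: "\<And>u. u \<in> U \<Longrightarrow> finite (B u) \<and> card (B u) \<le> a * p \<and> u permutes B u"
    by metis
  have "card (\<Union>u\<in>U. B u) \<le> (\<Sum>u\<in>U. card (B u))"
    by (rule card_UN_le[OF finU])
  also have "\<dots> \<le> card U * (a * p)"
    using B by (intro sum_bounded_above[of U "\<lambda>u. card (B u)" "a * p", simplified]) auto
  also have "\<dots> \<le> m * (a * p)"
    using U(2) by (rule mult_le_mono1)
  finally have "p \<le> card ({1..n} - (\<Union>u\<in>U. B u))"
    using n diff_card_le_card_Diff[of "\<Union>u\<in>U. B u" "{1..n}"] finU B by fastforce
  \<comment> \<open>Letters that no element of \<open>U\<close> moves: the new cycle lives on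
    them.\<close>
  then obtain T where T: "T \<subseteq> {1..n} - (\<Union>u\<in>U. B u)" "card T = p" "finite T"
    by (meson obtain_subset_with_card_n)
  then obtain cs where cs: "set cs = T" "distinct cs"
    using finite_distinct_list by blast
  have len: "length cs = p" and sub: "set cs \<subseteq> {1..n}"
    using T cs distinct_card[of cs] by auto
  let ?c = "cycle_of_list cs"
  \<comment> \<open>A single \<open>p\<close>-cycle qualifies because
    \<open>a \<ge> 1\<close>.\<close>
  have "product_of_disjoint_cycles p n a ?c"
    unfolding product_of_disjoint_cycles_def
    by (rule exI[of _ "[cs]"]) (use a cs len sub in \<open>auto simp: pairwise_def\<close>)
  then have c: "?c \<in> pverts (Lambda_graph p n a)"
    using ord_prime_cycle[OF p cs(2) len sub] by (simp add: Lambda_graph_def Let_def)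
  have "u \<circ> ?c = ?c \<circ> u" if "u \<in> U" for u
    by (rule permutes_disjoint_commute[of u "B u" ?c T]) (use B that T cs cycle_permutes[of cs] in auto)
  then have "\<forall>u\<in>U. ?c = u \<or> (u, ?c) \<in> parcs (Lambda_graph p n a)"
    using c U(1) by (auto simp: Lambda_graph_def Let_def sym_group_mult)
  with c show ?thesis
    by blast
qed

section \<open>The explicit bound on \<open>n\<close>\<close>

theorem theoremA:
  fixes p a :: nat
  assumes "prime p" and "a \<ge> 1"
  shows "highly_acyclic (\<lambda>n. K_complex p n a) \<and>
         (\<forall>k n. n \<ge> 2 * (k + 2) * a * p - 1 \<longrightarrow> k_acyclic (int k) (K_complex p n a))"
proof -
  have ac: "k_acyclic (int k) (K_complex p n a)" if n: "n \<ge> 2 * (k + 2) * a * p - 1" for k n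
    unfolding K_complex_def
  proof (rule k_acyclic_clique_complex[OF pair_graph_Lambda_graph])
    fix U assume U: "U \<subseteq> pverts (Lambda_graph p n a)" "card U \<le> 2 * k + 2"
    \<comment> \<open>Together these give \<open>p \<le> 2 * (a * p) - 1\<close>, which absorbs the
      \<open>- 1\<close> in the bound on \<open>n\<close>.\<close>
    have "p \<le> a * p" "1 \<le> a * p"
      using assms prime_gt_0_nat[of p] by (auto simp: Suc_le_eq)
    moreover have "2 * (k + 2) * a * p = (2 * k + 2) * (a * p) + 2 * (a * p)"
      by (simp add: algebra_simps)
    ultimately have "(2 * k + 2) * (a * p) + p \<le> n"
      using n by linarith
    then show "\<exists>c\<in>pverts (Lambda_graph p n a). \<forall>u\<in>U. c = u \<or> (u, c) \<in> parcs (Lambda_graph p n a)"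
      using Lambda_graph_common_neighbour assms U by blast
  qed
  have "highly_acyclic (\<lambda>n. K_complex p n a)"
    unfolding highly_acyclic_def
  proof (intro allI impI)
    fix k :: int assume "k \<ge> 0"
    then show "\<forall>\<^sub>F n in sequentially. k_acyclic k (K_complex p n a)"
      using ac[of "nat k"] by (auto simp: eventually_sequentially)
  qed
  with ac show ?thesis
    by blast
qed

end
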